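(* Let $V=\mathbb{R}^d$, let $T\subset V^*$ be a convex body that is smooth and strictly convex (equivalently, both $T$ and its polar $T^\circ\subset V$ are strictly convex), and measure lengths in $V$ using the (possibly non-symmetric) norm $\|\cdot\|_T$ with unit body $T^\circ$. Let $K\subset V$ be a convex body. If the shortest closed generalized billiard trajectory in $K$ (i.e. a closed generalized billiard trajectory in $K$ of minimal length $\ell_T$ among all closed generalized billiard trajectories in $K$) has $d+1$ bounces, then it is classical, that is, it does not pass through non-smooth points of $\partial K$.
   Context: A convex body is a compact convex set with nonempty interior. $V^*$ is the dual space of $V$, with canonical pairing $\langle\cdot,\cdot\rangle:V^*\times V\to\mathbb{R}$. The body $T\subset V^*$ contains the origin in its interior but is not necessarily centrally symmetric; $T^\circ=\{q\in V:\langle p,q\rangle\le 1\ \forall p\in T\}$, and $\|q\|_T=\max_{p\in T}\langle p,q\rangle$ (in general $\|q\|_T\ne\|-q\|_T$). The length of a closed polygonal line is $\ell_T(q_1,\dots,q_m)=\sum_{i=1}^m\|q_{i+1}-q_i\|_T$ with cyclic indexing. For $q\in\partial K$, the cone of outer normals is $N_K(q)=\{n\in V^*:\langle n,q'-q\rangle\le 0\ \forall q'\in K\}$; $q$ is a smooth point if $N_K(q)$ is a single ray and non-smooth otherwise. A polygonal line $q_{start}\to q_{refl}\to q_{end}$ with $q_{refl}\in\partial K$ and $q_{start},q_{end}\in K$ has a generalized billiard reflection at $q_{refl}$ if $q_{refl}\notin[q_{start},q_{end}]$ and there is a support hyperplane $H$ of $K$ at $q_{refl}$ such that $\varphi(q)=\|q_{end}-q\|_T+\|q-q_{start}\|_T$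 has a local minimum at $q=q_{refl}$ under the constraint $q\in H$. In differential form: $p'-p\in -N_K(q_{refl})$, $p'\neq p$, where the momenta $p,p'\in\partial T$ before and after the reflection are the unique points of $T$ at which $\langle\cdot,q_{refl}-q_{start}\rangle$, respectively $\langle\cdot,q_{end}-q_{refl}\rangle$, attains its maximum over $T$. A closed generalized billiard trajectory in $K$ with $m\ge 2$ bounces is a closed polygonal line $q_1\to\dots\to q_m\to q_1$ with all $q_i\in\partial K$ such that $q_{i-1}\to q_i\to q_{i+1}$ has a generalized billiard reflection at $q_i$ for every $i$ (cyclic indexing). It is classical if all its bounce points $q_i$ are smooth points of $\partial K$. *)

theory Defs
  imports "HOL-Analysis.Analysis"
begin

(* For V = R^d the dual space V* is identified with R^d by means of the dual basis, so that the
   canonical pairing <p, q> of p in V* and q in V is the dot product p \<bullet> q. *)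

definition convex_body :: "'a::euclidean_space set \<Rightarrow> bool" where
  "convex_body K \<longleftrightarrow> compact K \<and> convex K \<and> interior K \<noteq> {}"

definition normal_cone :: "'a::euclidean_space set \<Rightarrow> 'a \<Rightarrow> 'a set" where
  "normal_cone K q = {n. \<forall>q'\<in>K. n \<bullet> (q' - q) \<le> 0}"

definition smooth_point :: "'a::euclidean_space set \<Rightarrow> 'a \<Rightarrow> bool" where
  "smooth_point K q \<longleftrightarrow>
     q \<in> frontier K \<and> (\<exists>n. n \<noteq> 0 \<and> normal_cone K q = {t *\<^sub>R n | t. t \<ge> 0})"

definition smooth_body :: "'a::euclidean_space set \<Rightarrow> bool" where
  "smooth_body K \<longleftrightarrow> (\<forall>q\<in>frontier K. smooth_point K q)"

definition strictly_convex :: "'a::euclidean_space set \<Rightarrow> bool" where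
  "strictly_convex K \<longleftrightarrow> (\<forall>x\<in>K. \<forall>y\<in>K. x \<noteq> y \<longrightarrow> open_segment x y \<subseteq> interior K)"

(* ||q||_T = max_{p in T} <p, q>; T is always a convex body, so the supremum is attained. *)
definition T_norm :: "'a::euclidean_space set \<Rightarrow> 'a \<Rightarrow> real" where
  "T_norm T q = (SUP p\<in>T. p \<bullet> q)"

definition polar :: "'a::euclidean_space set \<Rightarrow> 'a set" where
  "polar T = {q. \<forall>p\<in>T. p \<bullet> q \<le> 1}"

lemma T_norm_attained:
  assumes "compact T" "T \<noteq> {}"
  shows "\<exists>p\<in>T. T_norm T q = p \<bullet> q \<and> (\<forall>p'\<in>T. p' \<bullet> q \<le> p \<bullet> q)"
proof -
  have "continuous_on T (\<lambda>p. p \<bullet> q)" by (intro continuous_intros)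
  from continuous_attains_sup[OF assms this]
  obtain p where p: "p \<in> T" "\<forall>p'\<in>T. p' \<bullet> q \<le> p \<bullet> q" by blast
  then have "T_norm T q = p \<bullet> q"
    unfolding T_norm_def by (intro cSup_eq_maximum) auto
  with p show ?thesis by blast
qed

lemma T_norm_unit_body:
  assumes "compact T" "T \<noteq> {}"
  shows "{q. T_norm T q \<le> 1} = polar T"
proof -
  have "T_norm T q \<le> 1 \<longleftrightarrow> (\<forall>p\<in>T. p \<bullet> q \<le> 1)" for q
  proof -
    obtain p where p: "p \<in> T" "T_norm T q = p \<bullet> q" "\<And>p'. p' \<in> T \<Longrightarrow> p' \<bullet> q \<le> p \<bullet> q"
      using T_norm_attained[OF assms] by metis
    then show ?thesis by (metis order_trans)
  qed
  then show ?thesis by (simp add: polar_def)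
qed

(* A polygonal line is the list of its vertices; the indices of a closed one are cyclic. *)
definition cyc_next :: "'a list \<Rightarrow> nat \<Rightarrow> 'a" where
  "cyc_next qs i = qs ! ((i + 1) mod length qs)"

definition cyc_prev :: "'a list \<Rightarrow> nat \<Rightarrow> 'a" where
  "cyc_prev qs i = qs ! ((i + length qs - 1) mod length qs)"

definition T_length :: "'a::euclidean_space set \<Rightarrow> 'a list \<Rightarrow> real" where
  "T_length T qs = (\<Sum>i<length qs. T_norm T (cyc_next qs i - qs ! i))"

definition support_hyperplane :: "'a::euclidean_space set \<Rightarrow> 'a \<Rightarrow> 'a set \<Rightarrow> bool" where
  "support_hyperplane K q H \<longleftrightarrow>
     (\<exists>n. n \<noteq> 0 \<and> H = {x. n \<bullet> x = n \<bullet> q} \<and> (\<forall>x\<in>K. n \<bullet> x \<le> n \<bullet> q))"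

definition generalized_reflection ::
    "'a::euclidean_space set \<Rightarrow> 'a set \<Rightarrow> 'a \<Rightarrow> 'a \<Rightarrow> 'a \<Rightarrow> bool" where
  "generalized_reflection K T q_start q_refl q_end \<longleftrightarrow>
     q_refl \<in> frontier K \<and> q_start \<in> K \<and> q_end \<in> K \<and>
     q_refl \<notin> closed_segment q_start q_end \<and>
     (\<exists>H. support_hyperplane K q_refl H \<and>
        (\<forall>\<^sub>F q in at q_refl within H.
           T_norm T (q_end - q_refl) + T_norm T (q_refl - q_start)
             \<le> T_norm T (q_end - q) + T_norm T (q - q_start)))"

definition closed_generalized_billiard_trajectory ::
    "'a::euclidean_space set \<Rightarrow> 'a set \<Rightarrow> 'a list \<Rightarrow> bool" where
  "closed_generalized_billiard_trajectory K T qs \<longleftrightarrow>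
     length qs \<ge> 2 \<and> set qs \<subseteq> frontier K \<and>
     (\<forall>i<length qs. generalized_reflection K T (cyc_prev qs i) (qs ! i) (cyc_next qs i))"

definition shortest_closed_generalized_billiard_trajectory ::
    "'a::euclidean_space set \<Rightarrow> 'a set \<Rightarrow> 'a list \<Rightarrow> bool" where
  "shortest_closed_generalized_billiard_trajectory K T qs \<longleftrightarrow>
     closed_generalized_billiard_trajectory K T qs \<and>
     (\<forall>rs. closed_generalized_billiard_trajectory K T rs \<longrightarrow> T_length T qs \<le> T_length T rs)"

definition classical_trajectory :: "'a::euclidean_space set \<Rightarrow> 'a list \<Rightarrow> bool" where
  "classical_trajectory K qs \<longleftrightarrow> (\<forall>q\<in>set qs. smooth_point K q)"

end

theory Submission
  imports Defs
begin

text \<open>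
  Say that a polygon \<^emph>\<open>fits\<close> if a translate of it lies in the interior of K. If every vertex
  carries an outer normal of K, these normals sum to zero and do not all vanish
  (\<^emph>\<open>balanced normals\<close>), then the polygon does not fit: a fitting translation would have
  negative pairing with every nonzero normal, yet the pairings sum to zero. The momentum changes
  of a billiard trajectory are balanced normals, so a trajectory never fits.

  The reduction behind everything is that, conversely, each polygon that does not fit is at
  least as long as some generalized trajectory (\<open>trajectory_not_longer_than_non_fitting\<close>). Among
  the non-fitting polygons with a given number of vertices there is a shortest one. If a vertex
  can be dropped so that the rest still does not fit, induct on the number of vertices; otherwise
  the polygon has balanced normals, and since moving one vertex within the hyperplane orthogonal
  to its normal keeps the polygon from fitting, minimality of the length is exactly the reflection
  law. Hence a shortest trajectory is also shortest among \<^emph>\<open>all\<close> non-fitting polygons.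

  Now let a shortest trajectory have d + 1 bounces with momentum changes G i, and suppose that the
  normal cone at the bounce k contains some w outside the ray of G k. The d + 1 vectors w and
  G i (i \<noteq> k) of a d-dimensional space satisfy a linear relation. If w does not occur in it, adding
  a multiple of the relation to the balance of the G i makes one normal vanish and leaves all
  coefficients nonnegative, so the corresponding vertex can be dropped; the shorter polygon does
  not fit, contradicting minimality. Otherwise a small multiple of the relation turns the G i into
  balanced normals whose k-th member is G k + e w with e > 0. The reflection law then holds at the
  bounce k for two different normals, although it makes both of them multiples of the same
  momentum change; this is the contradiction.
\<close>

section \<open>The norm and its momenta\<close>

locale length_body =
  fixes T :: "'a::euclidean_space set"
  assumes T_body: "convex_body T" and T_zero: "0 \<in> interior T"
    and T_smooth: "smooth_body T" and T_strict: "strictly_convex T"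
begin

lemma T_compact: "compact T" and T_convex: "convex T" and T_nonempty: "T \<noteq> {}"
  using T_body T_zero interior_subset by (auto simp: convex_body_def)

text \<open>A maximizer of the pairing with v over T. For v \<noteq> 0 it is unique because T is strictly
  convex, and it is then the derivative of the norm at v.\<close>
definition momentum :: "'a \<Rightarrow> 'a" where
  "momentum v = (SOME p. p \<in> T \<and> (\<forall>p'\<in>T. p' \<bullet> v \<le> p \<bullet> v))"

lemma momentum_max: "momentum v \<in> T" "p \<in> T \<Longrightarrow> p \<bullet> v \<le> momentum v \<bullet> v"
proof -
  have "\<exists>p. p \<in> T \<and> (\<forall>p'\<in>T. p' \<bullet> v \<le> p \<bullet> v)"
    using T_norm_attained[OF T_compact T_nonempty, of v] by blast
  from someI_ex[OF this] show "momentum v \<in> T" "p \<in> T \<Longrightarrow> p \<bullet> v \<le> momentum v \<bullet> v"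
    unfolding momentum_def by auto
qed

lemma T_norm_momentum: "T_norm T v = momentum v \<bullet> v"
proof -
  obtain p where "p \<in> T" "T_norm T v = p \<bullet> v" "\<forall>p'\<in>T. p' \<bullet> v \<le> p \<bullet> v"
    using T_norm_attained[OF T_compact T_nonempty, of v] by blast
  then show ?thesis
    using momentum_max by (auto intro: antisym)
qed

lemma pairing_le_T_norm: "p \<in> T \<Longrightarrow> p \<bullet> v \<le> T_norm T v"
  using momentum_max T_norm_momentum by simp

lemma T_norm_zero [simp]: "T_norm T 0 = 0"
  by (simp add: T_norm_momentum)

lemma T_norm_triangle: "T_norm T (u + v) \<le> T_norm T u + T_norm T v"
  using pairing_le_T_norm[OF momentum_max(1)[of "u + v"], of u]
    pairing_le_T_norm[OF momentum_max(1)[of "u + v"], of v]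
  by (simp add: T_norm_momentum[of "u + v"] inner_add_right)

lemma T_norm_scale: "0 \<le> c \<Longrightarrow> T_norm T (c *\<^sub>R v) = c * T_norm T v"
proof (cases "c = 0")
  case False
  assume "0 \<le> c"
  with False have c: "0 < c" by simp
  have "T_norm T (c *\<^sub>R v) \<le> c * T_norm T v"
    using pairing_le_T_norm[OF momentum_max(1)[of "c *\<^sub>R v"], of v] c by (simp add: T_norm_momentum[of "c *\<^sub>R v"])
  moreover have "c * T_norm T v \<le> T_norm T (c *\<^sub>R v)"
    using pairing_le_T_norm[OF momentum_max(1)[of v], of "c *\<^sub>R v"] by (simp add: T_norm_momentum[of v])
  ultimately show ?thesis by simp
qed simp

lemma T_norm_lower_bound: "\<exists>c>0. \<forall>v. c * norm v \<le> T_norm T v"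
proof -
  obtain c where c: "c > 0" "cball 0 c \<subseteq> T"
    using T_zero mem_interior_cball by blast
  have "c * norm v \<le> T_norm T v" for v
  proof (cases "v = 0")
    case False
    have "(c / norm v) *\<^sub>R v \<in> T"
      using c False by (auto intro!: subsetD[OF c(2)])
    from pairing_le_T_norm[OF this, of v] False show ?thesis
      by (simp add: dot_square_norm power2_eq_square)
  qed simp
  with c show ?thesis by blast
qed

lemma T_norm_pos: "v \<noteq> 0 \<Longrightarrow> 0 < T_norm T v"
proof -
  assume "v \<noteq> 0"
  obtain c where c: "c > 0" "c * norm v \<le> T_norm T v"
    using T_norm_lower_bound by blast
  from c(1) \<open>v \<noteq> 0\<close> have "0 < c * norm v" by simp
  with c(2) show ?thesis by linarith
qed

lemma T_norm_nonneg: "0 \<le> T_norm T v"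
  using T_norm_pos[of v] by (cases "v = 0") auto

lemma continuous_on_T_norm: "continuous_on S (T_norm T)"
proof -
  have "convex_on UNIV (T_norm T)"
  proof (rule convex_onI)
    fix t :: real and x y :: 'a
    assume "0 < t" "t < 1"
    then show "T_norm T ((1 - t) *\<^sub>R x + t *\<^sub>R y) \<le> (1 - t) * T_norm T x + t * T_norm T y"
      using T_norm_triangle[of "(1 - t) *\<^sub>R x" "t *\<^sub>R y"] by (simp add: T_norm_scale)
  qed simp
  then have "continuous_on UNIV (T_norm T)"
    by (intro convex_on_continuous) auto
  then show ?thesis
    using continuous_on_subset by blast
qed

text \<open>The midpoint of two maximizers would be an interior point of T at which a nonzero linear
  functional attains its maximum over T.\<close>
lemma momentum_unique:
  assumes "v \<noteq> 0" "p \<in> T" "T_norm T v \<le> p \<bullet> v"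
  shows "p = momentum v"
proof (rule ccontr)
  assume ne: "p \<noteq> momentum v"
  define m where "m = midpoint p (momentum v)"
  have "m \<in> open_segment p (momentum v)"
    using ne unfolding m_def by simp
  then have "m \<in> interior T"
    using T_strict ne assms(2) momentum_max(1) unfolding strictly_convex_def by blast
  then obtain e where e: "e > 0" "cball m e \<subseteq> T"
    using mem_interior_cball by blast
  have "m + (e / norm v) *\<^sub>R v \<in> T"
    using e assms(1) by (intro subsetD[OF e(2)]) (auto simp: dist_norm)
  from pairing_le_T_norm[OF this, of v]
  have "m \<bullet> v + e * norm v \<le> T_norm T v"
    using assms(1) by (simp add: inner_add_left dot_square_norm power2_eq_square)
  moreover have "m \<bullet> v \<ge> T_norm T v"
    using assms(3) by (simp add: m_def midpoint_def inner_add_left T_norm_momentum)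
  moreover have "e * norm v > 0" using e assms(1) by simp
  ultimately show False by linarith
qed

text \<open>Both vectors are outer normals of T at the common momentum, and there the normal cone of the
  smooth body T is a single ray.\<close>
lemma momentum_eq_imp_positively_parallel:
  assumes "u \<noteq> 0" "v \<noteq> 0" "momentum u = momentum v"
  shows "\<exists>c>0. u = c *\<^sub>R v"
proof -
  define p where "p = momentum v"
  have cone: "w \<in> normal_cone T p" if "momentum w = p" for w
    using momentum_max(2)[of _ w] that
    by (auto simp: normal_cone_def inner_diff_right inner_commute)
  have "p \<notin> interior T"
  proof
    assume "p \<in> interior T"
    then obtain e where e: "e > 0" "cball p e \<subseteq> T"
      using mem_interior_cball by blast
    have "p + (e / norm v) *\<^sub>R v \<in> T"
      using e assms(2) by (intro subsetD[OF e(2)]) (auto simp: dist_norm)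
    from momentum_max(2)[OF this, of v] have "e * (v \<bullet> v) / norm v \<le> 0"
      by (simp add: p_def inner_add_left)
    moreover have "e * (v \<bullet> v) / norm v > 0"
      using e assms(2) by simp
    ultimately show False by simp
  qed
  then have "p \<in> frontier T"
    using momentum_max(1) closure_subset by (auto simp: frontier_def p_def)
  then obtain n where n: "n \<noteq> 0" "normal_cone T p = {t *\<^sub>R n | t. t \<ge> 0}"
    using T_smooth by (auto simp: smooth_body_def smooth_point_def)
  obtain s t where "u = s *\<^sub>R n" "s \<ge> 0" "v = t *\<^sub>R n" "t \<ge> 0"
    using cone[of u] cone[of v] assms(3) n(2) by (auto simp: p_def)
  then have "u = (s / t) *\<^sub>R v" "s / t > 0" using assms by (auto simp: less_le)
  then show ?thesis by blast
qed

text \<open>In case of equality the momentum of the sum maximizes the pairing with each summand, so the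
  summands share a momentum.\<close>
lemma T_norm_strict_triangle:
  assumes "u \<noteq> 0" "v \<noteq> 0" "\<not> (\<exists>c>0. u = c *\<^sub>R v)"
  shows "T_norm T (u + v) < T_norm T u + T_norm T v"
proof (rule ccontr)
  assume "\<not> ?thesis"
  moreover have "T_norm T (u + v) = momentum (u + v) \<bullet> u + momentum (u + v) \<bullet> v"
    by (simp add: T_norm_momentum inner_add_right)
  moreover have "momentum (u + v) \<bullet> u \<le> T_norm T u" "momentum (u + v) \<bullet> v \<le> T_norm T v"
    by (simp_all add: pairing_le_T_norm momentum_max)
  ultimately have "T_norm T u \<le> momentum (u + v) \<bullet> u" "T_norm T v \<le> momentum (u + v) \<bullet> v"
    by linarith+
  then have "momentum (u + v) = momentum u" "momentum (u + v) = momentum v"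
    using momentum_unique[OF assms(1) momentum_max(1)] momentum_unique[OF assms(2) momentum_max(1)]
    by simp_all
  then show False
    using momentum_eq_imp_positively_parallel[OF assms(1,2)] assms(3) by simp
qed

text \<open>Outside a ball around the momentum of v the pairing with v stays below its maximum by a fixed
  gap, by compactness of T; a perturbation of v too small to bridge the gap keeps the maximizers
  inside the ball.\<close>
lemma momentum_continuous:
  assumes "v \<noteq> 0"
  shows "isCont momentum v"
proof -
  obtain B where B: "B > 0" "\<And>p. p \<in> T \<Longrightarrow> norm p \<le> B"
    using compact_imp_bounded[OF T_compact] by (auto simp: bounded_pos)
  have "\<exists>d>0. \<forall>w. dist w v < d \<longrightarrow> dist (momentum w) (momentum v) < e" if "e > 0" for e
  proof (cases "T - ball (momentum v) e = {}")
    case True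
    then have "dist (momentum w) (momentum v) < e" for w
      using momentum_max(1)[of w] by (auto simp: dist_commute)
    then show ?thesis by (intro exI[of _ 1]) auto
  next
    case False
    have "compact (T - ball (momentum v) e)"
      using T_compact by (simp add: compact_diff)
    moreover have "continuous_on (T - ball (momentum v) e) (\<lambda>p. p \<bullet> v)"
      by (intro continuous_intros)
    ultimately obtain p where p: "p \<in> T - ball (momentum v) e"
        "\<And>p'. p' \<in> T - ball (momentum v) e \<Longrightarrow> p' \<bullet> v \<le> p \<bullet> v"
      using continuous_attains_sup[OF _ False] by meson
    define \<eta> where "\<eta> = momentum v \<bullet> v - p \<bullet> v"
    have "\<eta> > 0"
    proof (rule ccontr)
      assume "\<not> ?thesis"
      then have "p = momentum v"
        using momentum_unique[OF assms, of p] p(1) by (simp add: \<eta>_def T_norm_momentum)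
      then show False using p(1) that by simp
    qed
    have "dist (momentum w) (momentum v) < e" if w: "dist w v < \<eta> / (2 * B)" for w
    proof (rule ccontr)
      assume "\<not> ?thesis"
      then have "momentum w \<bullet> v \<le> p \<bullet> v"
        using momentum_max(1)[of w] by (intro p(2)) (auto simp: dist_commute)
      moreover have "momentum v \<bullet> w \<le> momentum w \<bullet> w"
        using momentum_max by blast
      ultimately have "\<eta> \<le> (momentum w - momentum v) \<bullet> (w - v)"
        by (simp add: \<eta>_def algebra_simps)
      also have "\<dots> \<le> norm (momentum w - momentum v) * norm (w - v)"
        using norm_cauchy_schwarz by blast
      also have "\<dots> \<le> (2 * B) * norm (w - v)"
        using B(2)[OF momentum_max(1)[of w]] B(2)[OF momentum_max(1)[of v]]
          norm_triangle_ineq4[of "momentum w" "momentum v"]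
        by (intro mult_right_mono) auto
      also have "\<dots> < \<eta>"
        using w B(1) by (simp add: dist_norm field_simps)
      finally show False by simp
    qed
    then show ?thesis
      using \<open>\<eta> > 0\<close> B(1) by (intro exI[of _ "\<eta> / (2 * B)"]) auto
  qed
  then show ?thesis
    by (simp add: continuous_at_eps_delta)
qed

text \<open>The error of the linear approximation is at most the pairing of w - v with the difference of
  the momenta at w and v, and this difference tends to zero.\<close>
lemma T_norm_has_derivative:
  assumes "v \<noteq> 0"
  shows "(T_norm T has_derivative (\<lambda>h. momentum v \<bullet> h)) (at v)"
proof (rule has_derivativeI_sandwich[of 1])
  show "bounded_linear (\<lambda>h. momentum v \<bullet> h)" by (rule bounded_linear_inner_right)
  have "((\<lambda>w. norm (momentum w - momentum v)) \<longlongrightarrow> norm (momentum v - momentum v)) (at v)"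
    using momentum_continuous[OF assms] by (intro tendsto_intros) (simp add: isCont_def)
  then show "((\<lambda>w. norm (momentum w - momentum v)) \<longlongrightarrow> 0) (at v)" by simp
  fix w assume "w \<noteq> v"
  have "momentum v \<bullet> w \<le> momentum w \<bullet> w" "momentum w \<bullet> v \<le> momentum v \<bullet> v"
    using momentum_max by blast+
  then have "norm (T_norm T w - T_norm T v - momentum v \<bullet> (w - v))
      \<le> (momentum w - momentum v) \<bullet> (w - v)"
    by (simp add: T_norm_momentum algebra_simps)
  also have "\<dots> \<le> norm (momentum w - momentum v) * norm (w - v)"
    using norm_cauchy_schwarz by blast
  finally show "norm (T_norm T w - T_norm T v - momentum v \<bullet> (w - v)) / norm (w - v)
      \<le> norm (momentum w - momentum v)"
    using \<open>w \<noteq> v\<close> by (simp add: divide_le_eq)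
qed simp

end

section \<open>Cyclic polygons\<close>

lemma bij_betw_cyclic_shift:
  fixes m k :: nat
  assumes "0 < m"
  shows "bij_betw (\<lambda>i. (k + i) mod m) {..<m} {..<m}"
proof -
  define c where "c = m - k mod m"
  have "(k mod m + c) mod m = 0"
    using assms by (simp add: c_def less_imp_le)
  then have "(k + c) mod m = 0"
    by (simp add: mod_add_left_eq)
  then have shift: "(k + c + i) mod m = i mod m" for i
    by (metis add.left_neutral mod_add_left_eq)
  show ?thesis
  proof (rule bij_betw_byWitness[where f' = "\<lambda>i. (i + c) mod m"])
    show "\<forall>i\<in>{..<m}. ((k + i) mod m + c) mod m = i"
      using shift by (simp add: mod_simps ac_simps)
    show "\<forall>i\<in>{..<m}. (k + (i + c) mod m) mod m = i"
      using shift by (simp add: mod_simps ac_simps)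
  qed (use assms in auto)
qed

lemma sum_cyclic_shift:
  fixes m k :: nat
  shows "(\<Sum>i<m. g ((k + i) mod m)) = (\<Sum>i<m. g i)"
proof (cases "m = 0")
  case False
  then show ?thesis
    using sum.reindex_bij_betw[OF bij_betw_cyclic_shift[of m k], of g] by simp
qed simp

lemma T_length_rotate: "T_length T (rotate k qs) = T_length T qs"
proof -
  define m where "m = length qs"
  have "T_length T (rotate k qs) =
      (\<Sum>i<m. (\<lambda>j. T_norm T (cyc_next qs j - qs ! j)) ((k + i) mod m))"
    unfolding T_length_def m_def length_rotate
  proof (rule sum.cong)
    fix i assume "i \<in> {..<length qs}"
    then have "i < length qs" by simp
    moreover from this have "Suc i mod length qs < length qs"
      by (intro mod_less_divisor) linarith
    ultimately show "T_norm T (cyc_next (rotate k qs) i - rotate k qs ! i)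
        = T_norm T (cyc_next qs ((k + i) mod length qs) - qs ! ((k + i) mod length qs))"
      by (simp add: cyc_next_def nth_rotate mod_simps)
  qed simp
  also have "\<dots> = T_length T qs"
    by (subst sum_cyclic_shift) (simp add: T_length_def m_def)
  finally show ?thesis .
qed

lemma T_length_Cons:
  assumes "ys \<noteq> []"
  shows "T_length T (x # ys) + T_norm T (hd ys - last ys)
    = T_length T ys + T_norm T (hd ys - x) + T_norm T (x - last ys)"
proof -
  obtain l where l: "length ys = Suc l" using assms by (cases ys) auto
  define F where "F i = T_norm T (cyc_next (x # ys) i - (x # ys) ! i)" for i
  have hd: "hd ys = ys ! 0" and last: "last ys = ys ! l"
    using l assms by (auto simp: hd_conv_nth last_conv_nth)
  have inner: "F (Suc i) = T_norm T (ys ! Suc i - ys ! i)" if "i < l" for i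
    using that by (simp add: F_def cyc_next_def l)
  have "T_length T (x # ys) = (\<Sum>i<Suc (Suc l). F i)"
    by (simp add: T_length_def F_def l)
  also have "\<dots> = F 0 + (\<Sum>i<Suc l. F (Suc i))"
    by (rule sum.lessThan_Suc_shift)
  also have "\<dots> = F 0 + (\<Sum>i<l. T_norm T (ys ! Suc i - ys ! i)) + F (Suc l)"
    using inner by simp
  also have "F 0 = T_norm T (hd ys - x)"
    by (simp add: F_def cyc_next_def l hd)
  also have "F (Suc l) = T_norm T (x - last ys)"
    by (simp add: F_def cyc_next_def l last)
  finally have 1: "T_length T (x # ys) = T_norm T (hd ys - x)
      + (\<Sum>i<l. T_norm T (ys ! Suc i - ys ! i)) + T_norm T (x - last ys)" .
  have "T_length T ys = (\<Sum>i<l. T_norm T (ys ! Suc i - ys ! i)) + T_norm T (hd ys - last ys)"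
    by (simp add: T_length_def l cyc_next_def hd last)
  with 1 show ?thesis by simp
qed

text \<open>The vertices after the k-th one in cyclic order: rotating the polygon puts its gap at the ends
  of the list, so that the neighbours of the dropped vertex are the first and the last entry.\<close>
definition drop_vertex :: "nat \<Rightarrow> 'a list \<Rightarrow> 'a list" where
  "drop_vertex k qs = tl (rotate k qs)"

lemma length_drop_vertex [simp]: "length (drop_vertex k qs) = length qs - 1"
  by (simp add: drop_vertex_def)

lemma drop_vertex_nonempty: "2 \<le> length qs \<Longrightarrow> drop_vertex k qs \<noteq> []"
  by (metis One_nat_def diff_is_0_eq length_drop_vertex list.size(3) not_less_eq_eq numeral_2_eq_2)

lemma nth_drop_vertex:
  "i < length qs - 1 \<Longrightarrow> drop_vertex k qs ! i = qs ! ((k + Suc i) mod length qs)"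
  by (simp add: drop_vertex_def nth_tl nth_rotate)

lemma rotate_eq_Cons_drop_vertex:
  assumes "k < length qs"
  shows "rotate k qs = qs ! k # drop_vertex k qs"
proof -
  have "qs \<noteq> []" using assms by (cases qs) auto
  then have "rotate k qs \<noteq> []" by simp
  moreover have "hd (rotate k qs) = qs ! k"
    using assms \<open>qs \<noteq> []\<close> by (simp add: hd_rotate_conv_nth)
  ultimately show ?thesis by (metis drop_vertex_def list.collapse)
qed

lemma set_drop_vertex:
  assumes "k < length qs"
  shows "set (drop_vertex k qs) = (!) qs ` ({..<length qs} - {k})"
proof -
  define m where "m = length qs"
  have m: "0 < m" using assms unfolding m_def by linarith
  have bij: "bij_betw (\<lambda>i. (k + i) mod m) {..<m} {..<m}"
    by (rule bij_betw_cyclic_shift[OF m])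
  have "set (drop_vertex k qs) = (!) (drop_vertex k qs) ` {..<m - 1}"
    by (auto simp: set_conv_nth m_def)
  also have "\<dots> = (\<lambda>i. qs ! ((k + Suc i) mod m)) ` {..<m - 1}"
    by (rule image_cong) (simp_all add: nth_drop_vertex m_def)
  also have "\<dots> = (!) qs ` (\<lambda>i. (k + i) mod m) ` Suc ` {..<m - 1}"
    by (simp add: image_image)
  also have "Suc ` {..<m - 1} = {..<m} - {0}"
    using m by (cases m) (auto simp: image_iff less_Suc_eq_0_disj)
  also have "(\<lambda>i. (k + i) mod m) ` ({..<m} - {0}) = {..<m} - {k}"
    using bij m assms by (subst inj_on_image_set_diff[of _ "{..<m}"]) (auto simp: bij_betw_def m_def)
  finally show ?thesis by (simp add: m_def)
qed

lemma hd_drop_vertex: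
  assumes "2 \<le> length qs"
  shows "hd (drop_vertex k qs) = cyc_next qs k"
proof -
  have "drop_vertex k qs \<noteq> []"
    using assms drop_vertex_nonempty by blast
  then show ?thesis
    using assms by (simp add: hd_conv_nth nth_drop_vertex cyc_next_def)
qed

lemma last_drop_vertex:
  assumes "2 \<le> length qs"
  shows "last (drop_vertex k qs) = cyc_prev qs k"
proof -
  have "drop_vertex k qs \<noteq> []"
    using assms drop_vertex_nonempty by blast
  moreover have "Suc (length qs - 2) = length qs - 1" using assms by simp
  moreover have "k + (length qs - 1) = k + length qs - 1" using assms by simp
  ultimately show ?thesis
    using assms by (simp add: last_conv_nth nth_drop_vertex cyc_prev_def numeral_2_eq_2)
qed

lemma T_length_drop_vertex:
  assumes "2 \<le> length qs" "k < length qs"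
  shows "T_length T qs + T_norm T (cyc_next qs k - cyc_prev qs k)
    = T_length T (drop_vertex k qs)
      + T_norm T (cyc_next qs k - qs ! k) + T_norm T (qs ! k - cyc_prev qs k)"
proof -
  have "drop_vertex k qs \<noteq> []"
    using assms drop_vertex_nonempty by blast
  from T_length_Cons[OF this, of T "qs ! k"] show ?thesis
    using rotate_eq_Cons_drop_vertex[OF assms(2)] T_length_rotate[of T k qs]
    by (simp add: hd_drop_vertex last_drop_vertex assms(1))
qed

lemma neighbours_in_drop_vertex:
  assumes "2 \<le> length qs"
  shows "cyc_next qs k \<in> set (drop_vertex k qs)" "cyc_prev qs k \<in> set (drop_vertex k qs)"
proof -
  have "drop_vertex k qs \<noteq> []"
    using assms drop_vertex_nonempty by blast
  then show "cyc_next qs k \<in> set (drop_vertex k qs)" "cyc_prev qs k \<in> set (drop_vertex k qs)"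
    using hd_in_set last_in_set by (metis hd_drop_vertex assms, metis last_drop_vertex assms)
qed

lemma drop_vertex_list_update:
  assumes "k < length qs"
  shows "drop_vertex k (qs[k := x]) = drop_vertex k qs"
proof (rule nth_equalityI)
  fix i assume "i < length (drop_vertex k (qs[k := x]))"
  then have i: "i < length qs - 1" by simp
  have "(k + Suc i) mod length qs \<noteq> (k + 0) mod length qs"
    using bij_betw_imp_inj_on[OF bij_betw_cyclic_shift[of "length qs" k]] i assms
    by (metis inj_on_eq_iff lessThan_iff less_diff_conv add.commute plus_1_eq_Suc nat.distinct(1) gr_implies_not_zero not_gr_zero)
  then have "(k + Suc i) mod length qs \<noteq> k" using assms by simp
  then show "drop_vertex k (qs[k := x]) ! i = drop_vertex k qs ! i"
    using i by (simp add: nth_drop_vertex)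
qed simp

lemma T_length_list_update:
  assumes "2 \<le> length qs" "k < length qs"
  shows "T_length T (qs[k := x])
      + T_norm T (cyc_next qs k - qs ! k) + T_norm T (qs ! k - cyc_prev qs k)
    = T_length T qs + T_norm T (cyc_next qs k - x) + T_norm T (x - cyc_prev qs k)"
proof -
  have "cyc_next (qs[k := x]) k = cyc_next qs k" "cyc_prev (qs[k := x]) k = cyc_prev qs k"
    using assms drop_vertex_list_update[OF assms(2), of x]
      hd_drop_vertex[of "qs[k := x]" k] last_drop_vertex[of "qs[k := x]" k]
    by (simp_all add: hd_drop_vertex last_drop_vertex)
  then show ?thesis
    using T_length_drop_vertex[of "qs[k := x]" k T] T_length_drop_vertex[OF assms, of T] assms
    by (simp add: drop_vertex_list_update)
qed

section \<open>Normal cones and polygons that do not fit into the body\<close>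

lemma normal_cone_add: "u \<in> normal_cone K q \<Longrightarrow> v \<in> normal_cone K q \<Longrightarrow> u + v \<in> normal_cone K q"
  by (force simp: normal_cone_def inner_add_left)

lemma normal_cone_scale: "v \<in> normal_cone K q \<Longrightarrow> 0 \<le> c \<Longrightarrow> c *\<^sub>R v \<in> normal_cone K q"
  by (simp add: normal_cone_def mult_nonneg_nonpos)

lemma normal_cone_sum:
  "(\<And>i. i \<in> I \<Longrightarrow> v i \<in> normal_cone K q) \<Longrightarrow> sum v I \<in> normal_cone K q"
proof (induction I rule: infinite_finite_induct)
  case (insert i I)
  then show ?case by (simp add: normal_cone_add)
qed (simp_all add: normal_cone_def)

text \<open>A small step from y in the direction of n stays in K and increases the pairing with n.\<close>
lemma normal_cone_interior:
  assumes "n \<in> normal_cone K q" "n \<noteq> 0" "y \<in> interior K"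
  shows "n \<bullet> (y - q) < 0"
proof -
  obtain e where e: "e > 0" "cball y e \<subseteq> K"
    using assms(3) mem_interior_cball by blast
  have "y + (e / norm n) *\<^sub>R n \<in> K"
    using e(1) assms(2) by (intro subsetD[OF e(2)]) (auto simp: dist_norm)
  then have "n \<bullet> (y + (e / norm n) *\<^sub>R n - q) \<le> 0"
    using assms(1) by (simp add: normal_cone_def)
  then have "n \<bullet> (y - q) + e / norm n * (n \<bullet> n) \<le> 0"
    by (simp add: algebra_simps)
  moreover have "e / norm n * (n \<bullet> n) > 0"
    using e(1) assms(2) by simp
  ultimately show ?thesis by linarith
qed

locale billiard = length_body T for T :: "'a::euclidean_space set" +
  fixes K :: "'a set"
  assumes K_body: "convex_body K"
begin

lemma K_compact: "compact K" and K_convex: "convex K" and K_interior: "interior K \<noteq> {}"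
  using K_body by (auto simp: convex_body_def)

lemma normal_cone_pointed:
  assumes "n \<in> normal_cone K q" "- n \<in> normal_cone K q"
  shows "n = 0"
proof (rule ccontr)
  assume "n \<noteq> 0"
  obtain y where "y \<in> interior K" using K_interior by blast
  then have "n \<bullet> (y - q) < 0" "- n \<bullet> (y - q) < 0"
    using assms \<open>n \<noteq> 0\<close> by (auto simp del: inner_minus_left intro!: normal_cone_interior)
  then show False by simp
qed

definition fits :: "'a set \<Rightarrow> bool" where
  "fits S \<longleftrightarrow> (\<exists>t. \<forall>x\<in>S. x + t \<in> interior K)"

lemma fits_mono: "fits S \<Longrightarrow> S' \<subseteq> S \<Longrightarrow> fits S'"
  by (auto simp: fits_def)

lemma fits_translate: "fits ((\<lambda>x. x + a) ` S) \<longleftrightarrow> fits S"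
proof
  assume "fits ((\<lambda>x. x + a) ` S)"
  then obtain t where "\<forall>x\<in>S. x + a + t \<in> interior K" by (auto simp: fits_def)
  then show "fits S" unfolding fits_def by (intro exI[of _ "a + t"]) (simp add: add.assoc)
next
  assume "fits S"
  then obtain t where "\<forall>x\<in>S. x + t \<in> interior K" by (auto simp: fits_def)
  then show "fits ((\<lambda>x. x + a) ` S)" unfolding fits_def by (intro exI[of _ "t - a"]) simp
qed

lemma fits_singleton: "fits {x}"
proof -
  obtain y where "y \<in> interior K" using K_interior by blast
  then show ?thesis unfolding fits_def by (intro exI[of _ "y - x"]) simp
qed

text \<open>The polygon x may differ from the polygon q whose normals are used. It suffices that x is not,
  on weighted average, further inside the supporting half-spaces than q, a linear condition
  that survives moving vertices along these hyperplanes.\<close>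
lemma not_fits_if_balanced_normals:
  assumes "finite I" "\<And>i. i \<in> I \<Longrightarrow> N i \<in> normal_cone K (q i)"
    and "(\<Sum>i\<in>I. N i) = 0" "j \<in> I" "N j \<noteq> 0"
    and "0 \<le> (\<Sum>i\<in>I. N i \<bullet> (x i - q i))" and "x ` I \<subseteq> S"
  shows "\<not> fits S"
proof
  assume "fits S"
  then obtain t where t: "\<And>i. i \<in> I \<Longrightarrow> x i + t \<in> interior K"
    using assms(7) by (force simp: fits_def)
  have "(\<Sum>i\<in>I. N i \<bullet> (x i + t - q i)) < (\<Sum>i\<in>I. 0)"
  proof (rule sum_strict_mono_ex1)
    show "\<forall>i\<in>I. N i \<bullet> (x i + t - q i) \<le> 0"
      using assms(2) t interior_subset by (fastforce simp: normal_cone_def)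
    show "\<exists>i\<in>I. N i \<bullet> (x i + t - q i) < 0"
      using normal_cone_interior[OF assms(2)[OF assms(4)] assms(5) t[OF assms(4)]] assms(4) by blast
  qed (rule assms(1))
  moreover have "(\<Sum>i\<in>I. N i \<bullet> (x i + t - q i))
      = (\<Sum>i\<in>I. N i \<bullet> (x i - q i)) + (\<Sum>i\<in>I. N i) \<bullet> t"
    by (simp add: inner_sum_left sum.distrib[symmetric] inner_add_right inner_diff_right add_ac
        add_diff_eq diff_add_eq)
  ultimately show False using assms(3,6) by simp
qed

text \<open>A hyperplane separating the ray from q in direction a from the interior of K would have a
  normal in the normal cone at q that does not make an obtuse angle with a.\<close>
lemma enters_interior_if_obtuse_to_normals:
  assumes "q \<in> K" "\<And>n. n \<in> normal_cone K q \<Longrightarrow> norm n = 1 \<Longrightarrow> n \<bullet> a < 0"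
  shows "\<exists>\<epsilon>>0. \<forall>s. 0 < s \<and> s \<le> \<epsilon> \<longrightarrow> q + s *\<^sub>R a \<in> interior K"
proof -
  let ?R = "(\<lambda>s. q + s *\<^sub>R a) ` {0<..}"
  have "?R \<inter> interior K \<noteq> {}"
  proof
    assume "?R \<inter> interior K = {}"
    moreover have "convex ?R"
    proof -
      have "convex ((\<lambda>x. q + x) ` (\<lambda>s. s *\<^sub>R a) ` {0<..})"
        by (intro convex_translation convex_linear_image linearI) (auto simp: algebra_simps)
      then show ?thesis by (simp add: image_image)
    qed
    ultimately obtain n b where n: "n \<noteq> 0" "\<forall>x\<in>interior K. n \<bullet> x \<le> b" "\<forall>x\<in>?R. n \<bullet> x \<ge> b"
      using separating_hyperplane_sets[of "interior K" ?R] K_interior convex_interior[OF K_convex]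
      by (auto simp: Int_commute)
    have "K \<subseteq> closure (interior K)"
      using convex_closure_interior[OF K_convex K_interior] closure_subset by auto
    also have "\<dots> \<subseteq> {x. n \<bullet> x \<le> b}"
      using n(2) by (intro closure_minimal) (auto simp: closed_halfspace_le)
    finally have Kb: "n \<bullet> x \<le> b" if "x \<in> K" for x using that by auto
    have ray: "n \<bullet> q + s * (n \<bullet> a) \<ge> b" if "s > 0" for s
      using n(3) that by (force simp: inner_add_right)
    have "n \<bullet> q \<ge> b"
    proof (rule field_le_epsilon)
      fix e :: real assume "e > 0"
      define s where "s = e / (\<bar>n \<bullet> a\<bar> + 1)"
      have "s > 0" using \<open>e > 0\<close> by (simp add: s_def)
      have "s * (n \<bullet> a) \<le> s * (\<bar>n \<bullet> a\<bar> + 1)"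
        using \<open>s > 0\<close> by (intro mult_left_mono) auto
      also have "\<dots> = e" by (simp add: s_def)
      finally show "b \<le> n \<bullet> q + e" using ray[OF \<open>s > 0\<close>] by linarith
    qed
    then have nc: "n \<in> normal_cone K q"
      using Kb by (force simp: normal_cone_def inner_diff_right)
    have "n \<bullet> a \<ge> 0" using ray[of 1] Kb[OF assms(1)] by simp
    moreover have "((1 / norm n) *\<^sub>R n) \<bullet> a < 0"
      using n(1) by (intro assms(2) normal_cone_scale nc) auto
    ultimately show False using n(1) by (simp add: mult_less_0_iff divide_less_0_iff)
  qed
  then obtain e where e: "e > 0" "q + e *\<^sub>R a \<in> interior K" by auto
  have "q + s *\<^sub>R a \<in> interior K" if "0 < s" "s \<le> e" for s
  proof -
    have "q - (s / e) *\<^sub>R (q - (q + e *\<^sub>R a)) \<in> interior K"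
      using that e by (intro mem_interior_convex_shrink K_convex assms(1)) auto
    then show ?thesis using e by simp
  qed
  with e(1) show ?thesis by blast
qed

text \<open>If zero is not in the convex hull C of all unit normals at the vertices, then C, being compact,
  lies strictly on one side of a hyperplane through the origin, and a small translation in the
  opposite normal direction moves every vertex into the interior. So zero is a convex combination
  of unit normals; summing its terms vertex by vertex yields the balanced normals. They do not all
  vanish because normal cones of a body with interior points are pointed.\<close>
lemma balanced_normals_if_not_fits:
  fixes r :: "nat \<Rightarrow> 'a"
  assumes "\<And>i. i < m \<Longrightarrow> r i \<in> K" "\<not> fits (r ` {..<m})"
  shows "\<exists>N. (\<forall>i<m. N i \<in> normal_cone K (r i)) \<and> (\<Sum>i<m. N i) = 0 \<and> (\<exists>i<m. N i \<noteq> 0)"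
proof -
  define U where "U i = normal_cone K (r i) \<inter> sphere 0 1" for i
  define C where "C = convex hull (\<Union>i<m. U i)"
  have "compact (U i)" for i
  proof -
    have "normal_cone K (r i) = (\<Inter>y\<in>K. {n. n \<bullet> (y - r i) \<le> 0})"
      by (auto simp: normal_cone_def)
    moreover have "closed (\<Inter>y\<in>K. {n. n \<bullet> (y - r i) \<le> 0})"
    proof (intro closed_INT ballI)
      fix y show "closed {n. n \<bullet> (y - r i) \<le> 0}"
        using closed_halfspace_le[of "y - r i" 0] by (simp add: inner_commute)
    qed
    ultimately have "closed (normal_cone K (r i))" by simp
    then show ?thesis
      unfolding U_def by (intro closed_Int_compact compact_sphere)
  qed
  then have "closed C" unfolding C_def
    by (intro compact_imp_closed compact_convex_hull compact_UN) auto
  have "0 \<in> C"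
  proof (rule ccontr)
    assume "0 \<notin> C"
    then obtain a b where ab: "0 < b" "\<forall>x\<in>C. a \<bullet> x > b"
      using separating_hyperplane_closed_0[of C] \<open>closed C\<close> unfolding C_def by auto
    have "\<exists>\<epsilon>>0. \<forall>s. 0 < s \<and> s \<le> \<epsilon> \<longrightarrow> r i + s *\<^sub>R (- a) \<in> interior K" if "i < m" for i
    proof (rule enters_interior_if_obtuse_to_normals)
      fix n assume "n \<in> normal_cone K (r i)" "norm n = 1"
      then have "n \<in> (\<Union>i<m. U i)" using that by (auto simp: U_def)
      then have "n \<in> C" unfolding C_def by (rule hull_inc)
      then show "n \<bullet> - a < 0" using ab by (force simp: inner_commute)
    qed (use assms(1) that in auto)
    then obtain \<epsilon> where \<epsilon>: "\<And>i. i < m \<Longrightarrow> \<epsilon> i > 0"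
      "\<And>i s. i < m \<Longrightarrow> 0 < s \<Longrightarrow> s \<le> \<epsilon> i \<Longrightarrow> r i + s *\<^sub>R (- a) \<in> interior K"
      by metis
    define s where "s = Min (insert 1 (\<epsilon> ` {..<m}))"
    have "s > 0" "\<And>i. i < m \<Longrightarrow> s \<le> \<epsilon> i" using \<epsilon>(1) by (auto simp: s_def)
    then have "\<And>i. i < m \<Longrightarrow> r i + s *\<^sub>R (- a) \<in> interior K" using \<epsilon>(2) by blast
    then have "fits (r ` {..<m})" unfolding fits_def by blast
    then show False using assms(2) by simp
  qed
  then obtain S u where S: "finite S" "S \<subseteq> (\<Union>i<m. U i)" "\<And>x. x \<in> S \<Longrightarrow> 0 \<le> u x"
    "sum u S = (1::real)" "(\<Sum>v\<in>S. u v *\<^sub>R v) = 0"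
    unfolding C_def convex_hull_explicit mem_Collect_eq by blast
  have "\<forall>v\<in>S. \<exists>i. i < m \<and> v \<in> U i" using S(2) by blast
  then obtain idx where idx: "\<And>v. v \<in> S \<Longrightarrow> idx v < m \<and> v \<in> U (idx v)"
    by metis
  \<comment> \<open>A unit vector may be normal at several vertices; idx assigns each one to a single vertex.\<close>
  define N where "N i = (\<Sum>v\<in>{v\<in>S. idx v = i}. u v *\<^sub>R v)" for i
  have 1: "N i \<in> normal_cone K (r i)" for i
    unfolding N_def using idx S(3) by (intro normal_cone_sum normal_cone_scale) (auto simp: U_def)
  have 2: "(\<Sum>i<m. N i) = 0"
    unfolding N_def using sum.group[of S "{..<m}" idx "\<lambda>v. u v *\<^sub>R v"] S idx by (simp add: image_subset_iff)
  have "\<exists>v\<in>S. u v \<noteq> 0"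
  proof (rule ccontr)
    assume "\<not> ?thesis"
    then have "sum u S = 0" by simp
    with S(4) show False by simp
  qed
  then obtain v where v: "v \<in> S" "u v > 0"
    using S(3) by (metis less_le)
  define i where "i = idx v"
  obtain y where y: "y \<in> interior K" using K_interior by blast
  have "N i \<bullet> (y - r i) = (\<Sum>w\<in>{w\<in>S. idx w = i}. u w * (w \<bullet> (y - r i)))"
    by (simp add: N_def inner_sum_left)
  also have "\<dots> < (\<Sum>w\<in>{w\<in>S. idx w = i}. 0)"
  proof (rule sum_strict_mono_ex1)
    have neg: "w \<bullet> (y - r i) < 0" if "w \<in> S" "idx w = i" for w
      using idx[OF that(1)] that(2) y by (intro normal_cone_interior) (auto simp: U_def)
    show "\<forall>w\<in>{w \<in> S. idx w = i}. u w * (w \<bullet> (y - r i)) \<le> 0"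
      using neg S(3) by (intro ballI mult_nonneg_nonpos) (auto simp: less_imp_le)
    show "\<exists>w\<in>{w \<in> S. idx w = i}. u w * (w \<bullet> (y - r i)) < 0"
      using neg[of v] v by (intro bexI[of _ v] mult_pos_neg) (auto simp: i_def)
  qed (use S in simp)
  finally have "N i \<noteq> 0" by auto
  moreover have "i < m" using idx v by (simp add: i_def)
  ultimately show ?thesis using 1 2 by blast
qed

end

section \<open>Shortest polygons that do not fit\<close>

context length_body
begin

lemma T_length_translate: "T_length T (map (\<lambda>x. x + a) qs) = T_length T qs"
  unfolding T_length_def length_map
proof (rule sum.cong)
  fix i assume "i \<in> {..<length qs}"
  then have "i < length qs" by simp
  moreover from this have "(i + 1) mod length qs < length qs"
    by (intro mod_less_divisor) linarith
  ultimately show "T_norm T (cyc_next (map (\<lambda>x. x + a) qs) i - map (\<lambda>x. x + a) qs ! i)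
      = T_norm T (cyc_next qs i - qs ! i)"
    by (simp add: cyc_next_def)
qed simp

lemma T_length_scale:
  assumes "0 \<le> c"
  shows "T_length T (map (\<lambda>x. c *\<^sub>R x) qs) = c * T_length T qs"
  unfolding T_length_def length_map sum_distrib_left
proof (rule sum.cong)
  fix i assume "i \<in> {..<length qs}"
  then have "i < length qs" by simp
  moreover from this have "(i + 1) mod length qs < length qs"
    by (intro mod_less_divisor) linarith
  ultimately have "cyc_next (map (\<lambda>x. c *\<^sub>R x) qs) i - map (\<lambda>x. c *\<^sub>R x) qs ! i
      = c *\<^sub>R (cyc_next qs i - qs ! i)"
    by (simp add: cyc_next_def algebra_simps)
  then show "T_norm T (cyc_next (map (\<lambda>x. c *\<^sub>R x) qs) i - map (\<lambda>x. c *\<^sub>R x) qs ! i)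
      = c * T_norm T (cyc_next qs i - qs ! i)"
    using T_norm_scale[OF assms] by simp
qed simp

text \<open>The norm dominates a multiple of the Euclidean norm, which is applied to the edges of the path
  from the first to the i-th vertex.\<close>
lemma T_length_diameter_bound:
  "\<exists>c>0. \<forall>qs. \<forall>i<length qs. c * norm (qs ! i - qs ! 0) \<le> T_length T qs"
proof -
  obtain c where c: "c > 0" "\<And>v. c * norm v \<le> T_norm T v"
    using T_norm_lower_bound by blast
  have "c * norm (qs ! i - qs ! 0) \<le> T_length T qs" if "i < length qs" for i and qs :: "'a list"
  proof -
    have "c * norm (qs ! i - qs ! 0) \<le> (\<Sum>j<i. T_norm T (cyc_next qs j - qs ! j))"
      using that
    proof (induction i)
      case (Suc i)
      have "qs ! Suc i - qs ! 0 = (cyc_next qs i - qs ! i) + (qs ! i - qs ! 0)"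
        using Suc.prems by (simp add: cyc_next_def)
      then have "c * norm (qs ! Suc i - qs ! 0)
          \<le> c * norm (cyc_next qs i - qs ! i) + c * norm (qs ! i - qs ! 0)"
        using c(1) norm_triangle_ineq by (metis distrib_left mult_left_mono less_imp_le)
      then show ?case
        using c(2)[of "cyc_next qs i - qs ! i"] Suc by simp
    qed simp
    also have "\<dots> \<le> T_length T qs"
      unfolding T_length_def using that by (intro sum_mono2 T_norm_nonneg) auto
    finally show ?thesis .
  qed
  with c(1) show ?thesis by blast
qed

end

context billiard
begin

lemma T_length_pos_if_not_fits:
  assumes "\<not> fits (set qs)"
  shows "0 < T_length T qs"
proof (rule ccontr)
  assume nonpos: "\<not> ?thesis"
  obtain c where c: "c > 0" "\<And>i. i < length qs \<Longrightarrow> c * norm (qs ! i - qs ! 0) \<le> T_length T qs"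
    using T_length_diameter_bound by blast
  have "qs ! i = qs ! 0" if "i < length qs" for i
  proof -
    have "c * norm (qs ! i - qs ! 0) \<le> 0" using c(2)[OF that] nonpos by linarith
    then show ?thesis using c(1) by (simp add: mult_le_0_iff)
  qed
  then have "set qs \<subseteq> {qs ! 0}" by (auto simp: set_conv_nth)
  then show False using fits_mono[OF fits_singleton] assms by blast
qed

text \<open>Translating the first vertex to the origin and bounding the length confines the vertices to a
  ball. Not fitting is a closed condition, so the remaining polygons form a compact set of
  functions on the natural numbers, extended by zero beyond the vertices.\<close>
lemma shortest_not_fitting_exists:
  assumes "length xs = m" "\<not> fits (set xs)"
  shows "\<exists>zs. length zs = m \<and> \<not> fits (set zs) \<and>
    (\<forall>ys. length ys = m \<longrightarrow> \<not> fits (set ys) \<longrightarrow> T_length T zs \<le> T_length T ys)"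
proof -
  have "xs \<noteq> []" using assms(2) by (auto simp: fits_def)
  then have m: "0 < m" using assms(1) by auto
  obtain c where c: "c > 0"
    "\<And>qs i. i < length qs \<Longrightarrow> c * norm (qs ! i - qs ! 0) \<le> T_length T qs"
    using T_length_diameter_bound by blast
  define \<rho> where "\<rho> = T_length T xs / c"
  define len where "len f = T_length T (map f [0..<m])" for f :: "nat \<Rightarrow> 'a"
  define B :: "(nat \<Rightarrow> 'a) set" where "B = (\<Pi>\<^sub>E i\<in>UNIV. cball 0 \<rho>)"
  define C where "C = B \<inter> {f. \<not> fits (f ` {..<m})}"
  have "compact B"
    unfolding B_def using compactin_PiE[of "\<lambda>_. euclidean" UNIV "\<lambda>_. cball (0::'a) \<rho>"]
    by (simp add: euclidean_product_topology)
  moreover have "closed {f. \<not> fits (f ` {..<m})}"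
  proof -
    have coord: "continuous_on UNIV (\<lambda>f::nat \<Rightarrow> 'a. f i + t)" for i t
      by (intro continuous_intros continuous_on_product_coordinates)
    have "open {f. f i + t \<in> interior K}" for i :: nat and t :: 'a
      using open_vimage[OF open_interior[of K] coord[of i t]] by (simp add: vimage_def)
    then have "open (\<Union>t. \<Inter>i<m. {f. f i + t \<in> interior K})"
      by (intro open_UN open_INT) auto
    moreover have "{f. \<not> fits (f ` {..<m})} = - (\<Union>t. \<Inter>i<m. {f. f i + t \<in> interior K})"
      by (auto simp: fits_def)
    ultimately show ?thesis by (simp only: closed_Compl)
  qed
  ultimately have "compact C" unfolding C_def by (rule compact_Int_closed)
  have len: "len f = (\<Sum>i<m. T_norm T (f ((i + 1) mod m) - f i))" for f
    unfolding len_def T_length_def using m by (intro sum.cong) (auto simp: cyc_next_def)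
  have "continuous_on UNIV len"
    unfolding len by (intro continuous_on_sum continuous_on_compose2[OF continuous_on_T_norm[of UNIV]]
        continuous_on_diff continuous_on_product_coordinates) auto
  then have "continuous_on C len" by (rule continuous_on_subset) simp
  have into_C: "\<exists>f\<in>C. len f = T_length T ys"
    if ys: "length ys = m" "\<not> fits (set ys)" "T_length T ys \<le> T_length T xs" for ys
  proof
    define zs where "zs = map (\<lambda>x. x + (- ys ! 0)) ys"
    define f where "f i = (if i < m then zs ! i else 0)" for i
    have zs: "map f [0..<m] = zs"
      using ys(1) by (intro nth_equalityI) (auto simp: f_def zs_def)
    show "len f = T_length T ys"
      unfolding len_def zs unfolding zs_def by (rule T_length_translate)
    have "c * norm (ys ! i - ys ! 0) \<le> T_length T xs" if "i < m" for i
      using c(2)[of i ys] ys that by simp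
    then have "norm (f i) \<le> \<rho>" for i
      using ys(1) c(1) T_length_pos_if_not_fits[OF assms(2)]
      by (auto simp: f_def zs_def \<rho>_def field_simps)
    moreover have "f ` {..<m} = (\<lambda>x. x + (- ys ! 0)) ` set ys"
      using arg_cong[OF zs, of set] by (simp add: zs_def atLeast0LessThan)
    ultimately show "f \<in> C"
      using ys(2) fits_translate[of "- ys ! 0" "set ys"] by (simp add: C_def B_def PiE_UNIV_domain)
  qed
  have "C \<noteq> {}" using into_C[OF assms] by auto
  then obtain f where f: "f \<in> C" "\<And>g. g \<in> C \<Longrightarrow> len f \<le> len g"
    using continuous_attains_inf[OF \<open>compact C\<close> _ \<open>continuous_on C len\<close>] by blast
  have "T_length T (map f [0..<m]) \<le> T_length T ys" if ys: "length ys = m" "\<not> fits (set ys)" for ys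
  proof (cases "T_length T ys \<le> T_length T xs")
    case True
    obtain g where "g \<in> C" "len g = T_length T ys" using into_C[OF ys True] by blast
    then show ?thesis using f(2)[of g] by (simp add: len_def)
  next
    case False
    obtain g where "g \<in> C" "len g = T_length T xs" using into_C[OF assms order_refl] by blast
    then show ?thesis using f(2)[of g] False by (simp add: len_def)
  qed
  moreover have "\<not> fits (set (map f [0..<m]))"
    using f(1) by (simp add: C_def atLeast0LessThan)
  ultimately show ?thesis by (intro exI[of _ "map f [0..<m]"]) simp
qed

text \<open>Every contraction of the shortest polygon is shorter and therefore fits. Translations that move
  contractions with factor tending to one into K have a limit point.\<close>
lemma shortest_not_fitting_translates_into_K:
  assumes "\<not> fits (set zs)"
    and min: "\<And>ys. length ys = length zs \<Longrightarrow> \<not> fits (set ys) \<Longrightarrow> T_length T zs \<le> T_length T ys"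
  shows "\<exists>t. \<forall>x\<in>set zs. x + t \<in> K"
proof -
  define r :: "nat \<Rightarrow> real" where "r n = 1 - inverse (real (Suc n))" for n
  have r: "0 \<le> r n" "r n < 1" for n by (auto simp: r_def field_simps)
  have "fits (set (map (\<lambda>x. r n *\<^sub>R x) zs))" for n
  proof (rule ccontr)
    assume "\<not> ?thesis"
    then have "T_length T zs \<le> r n * T_length T zs"
      using min[of "map (\<lambda>x. r n *\<^sub>R x) zs"] T_length_scale[OF r(1)] by simp
    moreover have "r n * T_length T zs < 1 * T_length T zs"
      using T_length_pos_if_not_fits[OF assms(1)] r(2) by (intro mult_strict_right_mono) auto
    ultimately show False by simp
  qed
  then have "\<exists>t. \<forall>x\<in>set zs. r n *\<^sub>R x + t \<in> interior K" for n
    by (simp add: fits_def)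
  then obtain t where t: "\<And>n x. x \<in> set zs \<Longrightarrow> r n *\<^sub>R x + t n \<in> K"
    using interior_subset by (metis subsetD)
  have "zs \<noteq> []" using assms(1) by (auto simp: fits_def)
  then obtain x0 where x0: "x0 \<in> set zs" by (cases zs) auto
  obtain l \<sigma> where l: "l \<in> K" "strict_mono \<sigma>" "((\<lambda>n. r n *\<^sub>R x0 + t n) \<circ> \<sigma>) \<longlonglongrightarrow> l"
    using K_compact t[OF x0] unfolding compact_def by meson
  have "r \<longlonglongrightarrow> 1 - 0"
    unfolding r_def by (intro tendsto_intros LIMSEQ_inverse_real_of_nat)
  then have r1: "(r \<circ> \<sigma>) \<longlonglongrightarrow> 1"
    using LIMSEQ_subseq_LIMSEQ l(2) by force
  have "x + (l - x0) \<in> K" if "x \<in> set zs" for x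
  proof (rule closed_sequentially[of K])
    have "(\<lambda>n. (r \<circ> \<sigma>) n *\<^sub>R (x - x0) + ((\<lambda>n. r n *\<^sub>R x0 + t n) \<circ> \<sigma>) n) \<longlonglongrightarrow> 1 *\<^sub>R (x - x0) + l"
      by (intro tendsto_intros r1 l(3))
    then show "(\<lambda>n. r (\<sigma> n) *\<^sub>R x + t (\<sigma> n)) \<longlonglongrightarrow> x + (l - x0)"
      by (simp add: algebra_simps)
  qed (use t that K_compact compact_imp_closed in auto)
  then show ?thesis by blast
qed

end

section \<open>Reflections of shortest polygons\<close>

lemma mem_closed_segment_if_positively_parallel:
  fixes q :: "'a::real_vector"
  assumes "q - a = c *\<^sub>R (b - q)" "0 < c"
  shows "q \<in> closed_segment a b"
proof -
  have "(1 + c) *\<^sub>R q = a + c *\<^sub>R b"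
    using assms(1) by (simp add: algebra_simps)
  then have "q = (1 / (1 + c)) *\<^sub>R (a + c *\<^sub>R b)"
    using assms(2) by (metis add_pos_pos divide_inverse mult_1 scaleR_left_imp_eq
        scaleR_one scaleR_scaleR right_inverse zero_less_one less_irrefl)
  moreover have "1 - c / (1 + c) = 1 / (1 + c)"
    using assms(2) by (simp add: field_simps)
  ultimately show ?thesis
    using assms(2) unfolding in_segment
    by (intro exI[of _ "c / (1 + c)"]) (simp add: scaleR_add_right)
qed

context length_body
begin

lemma momentum_changes_at_bend:
  assumes "q \<notin> closed_segment a b"
  shows "momentum (q - a) \<noteq> momentum (b - q)"
proof
  assume "momentum (q - a) = momentum (b - q)"
  moreover have "q - a \<noteq> 0" "b - q \<noteq> 0" using assms by auto
  ultimately obtain c where "c > 0" "q - a = c *\<^sub>R (b - q)"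
    using momentum_eq_imp_positively_parallel by blast
  then show False
    using mem_closed_segment_if_positively_parallel assms by blast
qed

lemma T_length_drop_vertex_le:
  assumes "2 \<le> length qs" "k < length qs"
  shows "T_length T (drop_vertex k qs) \<le> T_length T qs"
  using T_length_drop_vertex[OF assms, of T]
    T_norm_triangle[of "cyc_next qs k - qs ! k" "qs ! k - cyc_prev qs k"] by simp

lemma T_length_drop_vertex_less:
  assumes "2 \<le> length qs" "k < length qs"
    and bend: "qs ! k \<notin> closed_segment (cyc_prev qs k) (cyc_next qs k)"
  shows "T_length T (drop_vertex k qs) < T_length T qs"
proof -
  have "qs ! k - cyc_prev qs k \<noteq> 0" "cyc_next qs k - qs ! k \<noteq> 0"
    using bend by auto
  moreover have "\<not> (\<exists>c>0. qs ! k - cyc_prev qs k = c *\<^sub>R (cyc_next qs k - qs ! k))"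
    using mem_closed_segment_if_positively_parallel bend by blast
  ultimately have "T_norm T ((qs ! k - cyc_prev qs k) + (cyc_next qs k - qs ! k))
      < T_norm T (qs ! k - cyc_prev qs k) + T_norm T (cyc_next qs k - qs ! k)"
    by (rule T_norm_strict_triangle)
  then show ?thesis
    using T_length_drop_vertex[OF assms(1,2), of T] by simp
qed

end

context billiard
begin

text \<open>The derivative of the two-leg length at q is the pairing with the momentum change, so at a
  minimum on the hyperplane the momentum change is a multiple of n. The factor is positive because
  moving q towards the start a shortens the first leg at full rate while the second leg
  cannot grow at the same rate at a genuine bend, whereas a lies on the inner side of the
  hyperplane.\<close>
lemma momentum_change_at_reflection:
  assumes bend: "q \<notin> closed_segment a b" and "a \<in> K" and n: "n \<in> normal_cone K q" "n \<noteq> 0"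
    and min: "\<forall>\<^sub>F x in at q within {x. n \<bullet> x = n \<bullet> q}.
      T_norm T (b - q) + T_norm T (q - a) \<le> T_norm T (b - x) + T_norm T (x - a)"
  shows "\<exists>c>0. momentum (q - a) - momentum (b - q) = c *\<^sub>R n"
proof -
  define \<phi> where "\<phi> x = T_norm T (b - x) + T_norm T (x - a)" for x
  define G where "G = momentum (q - a) - momentum (b - q)"
  have ne: "q - a \<noteq> 0" "b - q \<noteq> 0" using bend by auto
  obtain d where d: "d > 0" "\<And>x. n \<bullet> x = n \<bullet> q \<Longrightarrow> x \<noteq> q \<Longrightarrow> dist x q < d \<Longrightarrow> \<phi> q \<le> \<phi> x"
    using min by (auto simp: eventually_at \<phi>_def)
  have tangent: "G \<bullet> h = 0" if h: "n \<bullet> h = 0" for h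
  proof (cases "h = 0")
    case False
    have der1: "((\<lambda>s. T_norm T (q + s *\<^sub>R h - a)) has_derivative (\<lambda>s. momentum (q - a) \<bullet> (s *\<^sub>R h))) (at 0)"
      by (rule has_derivative_compose[where f = "\<lambda>s. q + s *\<^sub>R h - a" and g = "T_norm T", simplified])
        (use T_norm_has_derivative[OF ne(1)] in \<open>auto intro!: derivative_eq_intros\<close>)
    have der2: "((\<lambda>s. T_norm T (b - (q + s *\<^sub>R h))) has_derivative (\<lambda>s. momentum (b - q) \<bullet> (- (s *\<^sub>R h)))) (at 0)"
      by (rule has_derivative_compose[where f = "\<lambda>s. b - (q + s *\<^sub>R h)" and g = "T_norm T", simplified])
        (use T_norm_has_derivative[OF ne(2)] in \<open>auto intro!: derivative_eq_intros\<close>)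
    have "((\<lambda>s. \<phi> (q + s *\<^sub>R h)) has_derivative (\<lambda>s. (G \<bullet> h) * s)) (at 0)"
      unfolding \<phi>_def
      by (rule has_derivative_eq_rhs[OF has_derivative_add[OF der2 der1]])
        (auto simp: G_def algebra_simps)
    then have "((\<lambda>s. \<phi> (q + s *\<^sub>R h)) has_real_derivative G \<bullet> h) (at 0)"
      by (simp add: has_field_derivative_def)
    then show ?thesis
    proof (rule DERIV_local_min)
      show "0 < d / norm h" using d(1) False by simp
      show "\<forall>s. \<bar>0 - s\<bar> < d / norm h \<longrightarrow> \<phi> (q + 0 *\<^sub>R h) \<le> \<phi> (q + s *\<^sub>R h)"
      proof (intro allI impI)
        fix s :: real assume s: "\<bar>0 - s\<bar> < d / norm h"
        show "\<phi> (q + 0 *\<^sub>R h) \<le> \<phi> (q + s *\<^sub>R h)"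
        proof (cases "s = 0")
          case False
          then show ?thesis
            using s \<open>h \<noteq> 0\<close> h d(2)[of "q + s *\<^sub>R h"]
            by (simp add: inner_add_right dist_norm pos_less_divide_eq)
        qed simp
      qed
    qed
  qed simp
  define c where "c = (G \<bullet> n) / (n \<bullet> n)"
  define h where "h = G - c *\<^sub>R n"
  have nh: "n \<bullet> h = 0"
    using n(2) by (simp add: h_def c_def inner_diff_right inner_commute)
  have "h \<bullet> h = G \<bullet> h - c * (n \<bullet> h)" by (simp add: h_def inner_diff_left)
  then have "h = 0" using tangent[OF nh] nh by simp
  then have G: "G = c *\<^sub>R n" by (simp add: h_def)
  have "momentum (b - q) \<bullet> (q - a) < momentum (q - a) \<bullet> (q - a)"
  proof (rule ccontr)
    assume "\<not> ?thesis"
    then have "momentum (b - q) = momentum (q - a)"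
      using momentum_unique[OF ne(1) momentum_max(1)] by (simp add: T_norm_momentum)
    then show False using momentum_changes_at_bend[OF bend] by simp
  qed
  then have "G \<bullet> (q - a) > 0" by (simp add: G_def inner_diff_left)
  then have "c * (n \<bullet> (q - a)) > 0" by (simp add: G)
  moreover have "n \<bullet> (q - a) \<ge> 0"
    using n(1) \<open>a \<in> K\<close> by (force simp: normal_cone_def inner_diff_right)
  ultimately have "c > 0" by (simp add: zero_less_mult_iff)
  with G show ?thesis by (auto simp: G_def)
qed

text \<open>Moving the vertex k within the hyperplane orthogonal to its normal N k leaves the balance
  estimate unchanged, so the new polygon still does not fit and cannot be shorter; all edges but
  the two at the vertex k are the same. The normals are arbitrary here: the reflection law holds
  for every choice of balanced normals.\<close>
lemma shortest_polygon_reflects: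
  assumes "2 \<le> length qs" "k < length qs"
    and N: "\<And>i. i < length qs \<Longrightarrow> N i \<in> normal_cone K (qs ! i)"
      "(\<Sum>i<length qs. N i) = 0" "N k \<noteq> 0"
    and min: "\<And>ys. length ys = length qs \<Longrightarrow> \<not> fits (set ys) \<Longrightarrow> T_length T qs \<le> T_length T ys"
    and x: "N k \<bullet> x = N k \<bullet> (qs ! k)"
  shows "T_norm T (cyc_next qs k - qs ! k) + T_norm T (qs ! k - cyc_prev qs k)
    \<le> T_norm T (cyc_next qs k - x) + T_norm T (x - cyc_prev qs k)"
proof -
  have "\<not> fits (set (qs[k := x]))"
  proof (rule not_fits_if_balanced_normals[where I = "{..<length qs}" and N = N
        and q = "(!) qs" and x = "(!) (qs[k := x])" and j = k])
    have "N i \<bullet> (qs[k := x] ! i - qs ! i) = 0" for i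
      using x assms(2) by (cases "i = k") (auto simp: inner_diff_right)
    then show "0 \<le> (\<Sum>i<length qs. N i \<bullet> (qs[k := x] ! i - qs ! i))" by simp
    show "(!) (qs[k := x]) ` {..<length qs} \<subseteq> set (qs[k := x])"
      by (metis image_subsetI length_list_update lessThan_iff nth_mem)
  qed (use N assms(2) in auto)
  then have "T_length T qs \<le> T_length T (qs[k := x])"
    by (intro min) simp_all
  then show ?thesis
    using T_length_list_update[OF assms(1,2), of T x] by linarith
qed

lemma not_fits_drop_vertex_if_balanced_normals:
  assumes "k < length qs"
    and "\<And>i. i < length qs \<Longrightarrow> N i \<in> normal_cone K (qs ! i)" "(\<Sum>i<length qs. N i) = 0"
    and "N k = 0" "j < length qs" "N j \<noteq> 0"
  shows "\<not> fits (set (drop_vertex k qs))"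
proof (rule not_fits_if_balanced_normals[where I = "{..<length qs} - {k}" and N = N
      and q = "(!) qs" and x = "(!) qs" and j = j])
  show "(\<Sum>i\<in>{..<length qs} - {k}. N i) = 0"
    using assms(1,3,4) by (simp add: sum_diff1)
qed (use assms in \<open>auto simp: set_drop_vertex\<close>)

lemma fits_if_drop_straight_vertex_fits:
  assumes "2 \<le> length qs" "k < length qs"
    and "qs ! k \<in> closed_segment (cyc_prev qs k) (cyc_next qs k)"
    and "fits (set (drop_vertex k qs))"
  shows "fits (set qs)"
proof -
  obtain t where t: "\<And>x. x \<in> set (drop_vertex k qs) \<Longrightarrow> x + t \<in> interior K"
    using assms(4) by (auto simp: fits_def)
  obtain u where u: "0 \<le> u" "u \<le> 1" "qs ! k = (1 - u) *\<^sub>R cyc_prev qs k + u *\<^sub>R cyc_next qs k"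
    using assms(3) by (auto simp: in_segment)
  have "(1 - u) *\<^sub>R (cyc_prev qs k + t) + u *\<^sub>R (cyc_next qs k + t) \<in> interior K"
    using u t neighbours_in_drop_vertex[OF assms(1)] convex_interior[OF K_convex]
    by (intro convexD) auto
  moreover have "(1 - u) *\<^sub>R (cyc_prev qs k + t) + u *\<^sub>R (cyc_next qs k + t) = qs ! k + t"
    by (simp add: u(3) algebra_simps)
  ultimately have "qs ! k + t \<in> interior K" by simp
  moreover have "set qs = insert (qs ! k) (set (drop_vertex k qs))"
    using rotate_eq_Cons_drop_vertex[OF assms(2)] by (metis list.simps(15) set_rotate)
  ultimately show ?thesis using t by (auto simp: fits_def)
qed

text \<open>That no vertex can be dropped excludes all degenerations at once: a zero normal at a
  vertex, and a vertex on the segment between its neighbours (in particular equal to one of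
  them).\<close>
lemma shortest_irreducible_polygon_is_trajectory:
  assumes "set qs \<subseteq> K" "\<not> fits (set qs)"
    and min: "\<And>ys. length ys = length qs \<Longrightarrow> \<not> fits (set ys) \<Longrightarrow> T_length T qs \<le> T_length T ys"
    and irred: "\<And>k. k < length qs \<Longrightarrow> fits (set (drop_vertex k qs))"
  shows "closed_generalized_billiard_trajectory K T qs"
proof -
  have "length qs \<noteq> 0" using assms(2) by (auto simp: fits_def)
  moreover have "length qs \<noteq> 1"
    using assms(2) fits_singleton by (auto simp: length_Suc_conv)
  ultimately have m: "2 \<le> length qs" by linarith
  have set_qs: "set qs = (!) qs ` {..<length qs}" by (auto simp: set_conv_nth)
  obtain N where N: "\<And>i. i < length qs \<Longrightarrow> N i \<in> normal_cone K (qs ! i)"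
    "(\<Sum>i<length qs. N i) = 0" and ex: "\<exists>i<length qs. N i \<noteq> 0"
    using balanced_normals_if_not_fits[of "length qs" "(!) qs"] assms(1,2) set_qs by auto
  have N0: "N k \<noteq> 0" if "k < length qs" for k
    using not_fits_drop_vertex_if_balanced_normals[OF that N] irred[OF that] ex by blast
  have front: "qs ! k \<in> frontier K" if "k < length qs" for k
  proof -
    have "qs ! k \<notin> interior K"
      using normal_cone_interior[OF N(1)[OF that] N0[OF that]] by fastforce
    then show ?thesis
      using assms(1) that closure_subset by (force simp: frontier_def)
  qed
  have "generalized_reflection K T (cyc_prev qs k) (qs ! k) (cyc_next qs k)"
    if k: "k < length qs" for k
    unfolding generalized_reflection_def
  proof (intro conjI exI[of _ "{x. N k \<bullet> x = N k \<bullet> (qs ! k)}"])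
    show "cyc_prev qs k \<in> K" "cyc_next qs k \<in> K"
      using neighbours_in_drop_vertex[OF m, of k] assms(1) set_drop_vertex[OF k] set_qs by auto
    show "qs ! k \<notin> closed_segment (cyc_prev qs k) (cyc_next qs k)"
      using fits_if_drop_straight_vertex_fits[OF m k _ irred[OF k]] assms(2) by blast
    show "support_hyperplane K (qs ! k) {x. N k \<bullet> x = N k \<bullet> (qs ! k)}"
      using N(1)[OF k] N0[OF k] unfolding support_hyperplane_def
      by (intro exI[of _ "N k"]) (auto simp: normal_cone_def inner_diff_right)
    show "\<forall>\<^sub>F q in at (qs ! k) within {x. N k \<bullet> x = N k \<bullet> (qs ! k)}.
       T_norm T (cyc_next qs k - qs ! k) + T_norm T (qs ! k - cyc_prev qs k)
       \<le> T_norm T (cyc_next qs k - q) + T_norm T (q - cyc_prev qs k)"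
      using shortest_polygon_reflects[OF m k N N0[OF k] min]
      by (auto simp: eventually_at intro!: exI[of _ 1])
  qed (rule front[OF k])
  with m front show ?thesis
    unfolding closed_generalized_billiard_trajectory_def set_qs by blast
qed

text \<open>A shortest non-fitting polygon with the same number of vertices is a trajectory or has a
  superfluous vertex; dropping it does not increase the length by the triangle inequality.\<close>
lemma trajectory_not_longer_than_non_fitting:
  "\<not> fits (set xs) \<Longrightarrow>
    \<exists>rs. closed_generalized_billiard_trajectory K T rs \<and> T_length T rs \<le> T_length T xs"
proof (induction "length xs" arbitrary: xs rule: less_induct)
  case less
  obtain zs where zs: "length zs = length xs" "\<not> fits (set zs)"
    "\<And>ys. length ys = length xs \<Longrightarrow> \<not> fits (set ys) \<Longrightarrow> T_length T zs \<le> T_length T ys"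
    using shortest_not_fitting_exists[OF refl less.prems] by blast
  obtain t where t: "\<And>x. x \<in> set zs \<Longrightarrow> x + t \<in> K"
    using shortest_not_fitting_translates_into_K[OF zs(2)] zs(1,3) by metis
  define rs where "rs = map (\<lambda>x. x + t) zs"
  have len: "length rs = length xs" using zs(1) by (simp add: rs_def)
  have rs_le: "T_length T rs \<le> T_length T ys" if "length ys = length xs" "\<not> fits (set ys)" for ys
    using zs(3)[OF that] by (simp add: rs_def T_length_translate)
  have "set rs \<subseteq> K" using t by (auto simp: rs_def)
  have "\<not> fits (set rs)" using zs(2) by (simp add: rs_def fits_translate)
  show ?case
  proof (cases "\<exists>k<length rs. \<not> fits (set (drop_vertex k rs))")
    case True
    then obtain k where k: "k < length rs" "\<not> fits (set (drop_vertex k rs))" by blast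
    have "drop_vertex k rs \<noteq> []" using k(2) by (auto simp: fits_def)
    then have "0 < length (drop_vertex k rs)" by blast
    then have "2 \<le> length rs" by simp
    have "length (drop_vertex k rs) < length xs" using k(1) len by simp
    then obtain ts where "closed_generalized_billiard_trajectory K T ts"
      "T_length T ts \<le> T_length T (drop_vertex k rs)"
      using less.hyps k(2) by blast
    moreover have "T_length T (drop_vertex k rs) \<le> T_length T xs"
      using T_length_drop_vertex_le[OF \<open>2 \<le> length rs\<close> k(1)] rs_le[OF refl less.prems] by simp
    ultimately show ?thesis by (meson order_trans)
  next
    case False
    have "closed_generalized_billiard_trajectory K T rs"
      using \<open>set rs \<subseteq> K\<close> \<open>\<not> fits (set rs)\<close> rs_le False
      by (intro shortest_irreducible_polygon_is_trajectory) (auto simp: len)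
    then show ?thesis using rs_le[OF refl less.prems] by blast
  qed
qed

end

section \<open>Shortest trajectories of maximal bounce number\<close>

lemma nontrivial_linear_relation:
  fixes f :: "nat \<Rightarrow> 'a::euclidean_space"
  assumes "DIM('a) < m"
  shows "\<exists>u. (\<exists>i<m. u i \<noteq> 0) \<and> (\<Sum>i<m. u i *\<^sub>R f i) = 0"
proof (cases "inj_on f {..<m}")
  case True
  then have "dependent (f ` {..<m})"
    using assms by (intro dependent_biggerset) (simp add: card_image)
  then obtain u v where "v \<in> f ` {..<m}" "u v \<noteq> 0" "(\<Sum>v\<in>f ` {..<m}. u v *\<^sub>R v) = 0"
    by (auto simp: dependent_finite)
  then show ?thesis
    using True by (intro exI[of _ "u \<circ> f"]) (auto simp: sum.reindex)
next
  case False
  then obtain i j where ij: "i < m" "j < m" "i \<noteq> j" "f i = f j"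
    by (auto simp: inj_on_def)
  define u where "u l = (if l = i then 1 else 0) - (if l = j then 1 else (0::real))" for l
  have "(\<Sum>l<m. u l *\<^sub>R f l) = (\<Sum>l<m. if l = i then f l else 0) - (\<Sum>l<m. if l = j then f l else 0)"
    unfolding sum_subtractf[symmetric] by (intro sum.cong) (auto simp: u_def)
  also have "\<dots> = 0" using ij by simp
  finally show ?thesis using ij by (intro exI[of _ u]) (auto simp: u_def)
qed

lemma normal_cone_if_support_hyperplane:
  assumes "support_hyperplane K q H"
  obtains n where "n \<noteq> 0" "n \<in> normal_cone K q" "H = {x. n \<bullet> x = n \<bullet> q}"
  using assms by (auto simp: support_hyperplane_def normal_cone_def inner_diff_right)

context billiard
begin

text \<open>The order of the difference makes it an outer normal of K at a reflection.\<close>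
definition momentum_change :: "'a list \<Rightarrow> nat \<Rightarrow> 'a" where
  "momentum_change qs i = momentum (qs ! i - cyc_prev qs i) - momentum (cyc_next qs i - qs ! i)"

lemma sum_momentum_change: "(\<Sum>i<length qs. momentum_change qs i) = 0"
proof -
  define m where "m = length qs"
  define P where "P j = momentum (cyc_next qs j - qs ! j)" for j
  have "momentum (qs ! i - cyc_prev qs i) = P ((m - 1 + i) mod m)" if "i < m" for i
  proof -
    have "((m - 1 + i) mod m + 1) mod m = i"
      using that by (simp add: mod_simps)
    then show ?thesis
      using that unfolding P_def by (simp add: cyc_next_def cyc_prev_def m_def add.commute)
  qed
  then have "(\<Sum>i<m. momentum_change qs i) = (\<Sum>i<m. P ((m - 1 + i) mod m)) - (\<Sum>i<m. P i)"
    by (simp add: momentum_change_def P_def sum_subtractf)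
  then show ?thesis
    by (simp only: sum_cyclic_shift[where g = P] m_def diff_self)
qed

lemma trajectory_momentum_change:
  assumes "closed_generalized_billiard_trajectory K T qs" "i < length qs"
  shows "momentum_change qs i \<in> normal_cone K (qs ! i)" "momentum_change qs i \<noteq> 0"
    and "qs ! i \<notin> closed_segment (cyc_prev qs i) (cyc_next qs i)"
proof -
  have refl: "generalized_reflection K T (cyc_prev qs i) (qs ! i) (cyc_next qs i)"
    using assms by (simp add: closed_generalized_billiard_trajectory_def)
  then show bend: "qs ! i \<notin> closed_segment (cyc_prev qs i) (cyc_next qs i)"
    by (simp add: generalized_reflection_def)
  from refl obtain H where H: "support_hyperplane K (qs ! i) H"
    "\<forall>\<^sub>F q in at (qs ! i) within H. T_norm T (cyc_next qs i - qs ! i) + T_norm T (qs ! i - cyc_prev qs i)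
      \<le> T_norm T (cyc_next qs i - q) + T_norm T (q - cyc_prev qs i)"
    and "cyc_prev qs i \<in> K"
    by (auto simp: generalized_reflection_def)
  obtain n where n: "n \<noteq> 0" "n \<in> normal_cone K (qs ! i)" "H = {x. n \<bullet> x = n \<bullet> (qs ! i)}"
    using normal_cone_if_support_hyperplane[OF H(1)] .
  obtain c where "c > 0" "momentum_change qs i = c *\<^sub>R n"
    using momentum_change_at_reflection[OF bend \<open>cyc_prev qs i \<in> K\<close> n(2,1)] H(2) n(3)
    by (auto simp: momentum_change_def)
  then show "momentum_change qs i \<in> normal_cone K (qs ! i)" "momentum_change qs i \<noteq> 0"
    using n normal_cone_scale[of n K "qs ! i" c] by auto
qed

text \<open>An additional normal w at the bounce k and the momentum changes at the other d bounces satisfy a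
  linear relation. The coefficient of w in it decides whether a vertex can be dropped or the
  reflection law holds for two different normals.\<close>
theorem shortest_trajectory_classical:
  assumes shortest: "shortest_closed_generalized_billiard_trajectory K T qs"
    and len: "length qs = DIM('a) + 1"
  shows "classical_trajectory K qs"
proof -
  define m where "m = length qs"
  define G where "G = momentum_change qs"
  have traj: "closed_generalized_billiard_trajectory K T qs"
    using shortest by (simp add: shortest_closed_generalized_billiard_trajectory_def)
  have m2: "2 \<le> length qs" using traj by (simp add: closed_generalized_billiard_trajectory_def)
  have min: "T_length T qs \<le> T_length T ys" if "\<not> fits (set ys)" for ys
    using trajectory_not_longer_than_non_fitting[OF that] shortest
    by (meson order_trans shortest_closed_generalized_billiard_trajectory_def)
  have G: "G i \<in> normal_cone K (qs ! i)" "G i \<noteq> 0" if "i < m" for i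
    using trajectory_momentum_change(1,2)[OF traj] that by (auto simp: G_def m_def)
  have G_sum: "(\<Sum>i<m. G i) = 0" by (simp add: G_def m_def sum_momentum_change)
  have "smooth_point K (qs ! k)" if k: "k < m" for k
  proof (rule ccontr)
    assume "\<not> ?thesis"
    moreover have "qs ! k \<in> frontier K"
      using traj k by (auto simp: closed_generalized_billiard_trajectory_def m_def)
    ultimately have "normal_cone K (qs ! k) \<noteq> {t *\<^sub>R G k | t. t \<ge> 0}"
      using G(2)[OF k] by (auto simp: smooth_point_def)
    moreover have "{t *\<^sub>R G k | t. t \<ge> 0} \<subseteq> normal_cone K (qs ! k)"
      using normal_cone_scale[OF G(1)[OF k]] by blast
    ultimately obtain w where w: "w \<in> normal_cone K (qs ! k)" "\<And>t. t \<ge> 0 \<Longrightarrow> w \<noteq> t *\<^sub>R G k"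
      by blast
    define f where "f = G(k := w)"
    have f: "f i \<in> normal_cone K (qs ! i)" if "i < m" for i
      using G(1)[OF that] w(1) by (simp add: f_def)
    obtain v where v: "\<exists>i<m. v i \<noteq> 0" "(\<Sum>i<m. v i *\<^sub>R f i) = 0"
      using nontrivial_linear_relation[of m f] len by (auto simp: m_def)
    \<comment> \<open>The sign of the relation is chosen such that w enters with a nonnegative coefficient and,
      if that coefficient is zero, some other coefficient is negative.\<close>
    have "\<exists>u. (u k > 0 \<or> (u k = 0 \<and> (\<exists>j<m. u j < 0))) \<and> (\<Sum>i<m. u i *\<^sub>R f i) = 0"
    proof (cases "v k > 0 \<or> (v k = 0 \<and> (\<exists>j<m. v j < 0))")
      case True
      with v show ?thesis by blast
    next
      case False
      moreover obtain j where "j < m" "v j \<noteq> 0" using v(1) by blast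
      ultimately have "- v k > 0 \<or> (- v k = 0 \<and> (\<exists>j<m. - v j < 0))"
        by (metis linorder_neqE_linordered_idom neg_0_less_iff_less neg_less_0_iff_less neg_equal_0_iff_equal)
      then show ?thesis
        using v(2) by (intro exI[of _ "\<lambda>i. - v i"]) (simp add: sum_negf)
    qed
    then obtain u where u: "u k > 0 \<or> (u k = 0 \<and> (\<exists>j<m. u j < 0))" "(\<Sum>i<m. u i *\<^sub>R f i) = 0"
      by blast
    \<comment> \<open>The momentum changes are balanced, and so they remain after adding multiples of the relation.\<close>
    define N where "N s i = G i + (s * u i) *\<^sub>R f i" for s i
    have N_sum: "(\<Sum>i<m. N s i) = 0" for s
      using G_sum u(2) by (simp add: N_def sum.distrib scaleR_scaleR[symmetric] scaleR_sum_right[symmetric] del: scaleR_scaleR)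
    have N_other: "N s i = (1 + s * u i) *\<^sub>R G i" if "i \<noteq> k" for s i
      using that by (simp add: N_def f_def scaleR_add_left)
    have N_cone: "N s i \<in> normal_cone K (qs ! i)"
      if "i < m" "0 \<le> s" "0 \<le> 1 + s * u i" for s i
    proof (cases "i = k")
      case True
      then show ?thesis
        using u(1) that f[OF that(1)] G(1)[OF that(1)] unfolding N_def
        by (intro normal_cone_add normal_cone_scale) auto
    next
      case False
      then show ?thesis using G(1)[OF that(1)] that(3) by (simp add: N_other normal_cone_scale)
    qed
    show False
    proof (cases "u k = 0")
      case True
      obtain j where j: "j < m" "\<And>i. i < m \<Longrightarrow> u j \<le> u i"
        using k ex_min_if_finite[of "u ` {..<m}"] by (force simp: not_less)
      have "u j < 0" using u(1) True j(2) by force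
      \<comment> \<open>The first s at which a coefficient 1 + s * u i vanishes, namely that of the least u i.\<close>
      define s where "s = - 1 / u j"
      have s: "0 < s" using \<open>u j < 0\<close> by (simp add: s_def)
      have "j \<noteq> k" using \<open>u j < 0\<close> True by auto
      have "0 \<le> 1 + s * u i" if "i < m" for i
        using mult_left_mono[OF j(2)[OF that], of s] s \<open>u j < 0\<close> by (simp add: s_def)
      then have "\<And>i. i < m \<Longrightarrow> N s i \<in> normal_cone K (qs ! i)" using N_cone s by simp
      moreover have "N s j = 0" using N_other[OF \<open>j \<noteq> k\<close>] \<open>u j < 0\<close> by (simp add: s_def)
      moreover have "N s k \<noteq> 0" using G(2)[OF k] True by (simp add: N_def)
      ultimately have "\<not> fits (set (drop_vertex j qs))"
        using not_fits_drop_vertex_if_balanced_normals[of j qs "N s" k] j(1) k N_sum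
        by (simp add: m_def)
      then have "T_length T qs \<le> T_length T (drop_vertex j qs)" by (rule min)
      moreover have "T_length T (drop_vertex j qs) < T_length T qs"
        using T_length_drop_vertex_less[OF m2] trajectory_momentum_change(3)[OF traj] j(1)
        by (simp add: m_def)
      ultimately show False by simp
    next
      case False
      with u(1) have uk: "u k > 0" by simp
      \<comment> \<open>Small enough that all coefficients 1 + s * u i stay nonnegative.\<close>
      define s where "s = 1 / (1 + (\<Sum>i<m. \<bar>u i\<bar>))"
      have S: "0 < 1 + (\<Sum>i<m. \<bar>u i\<bar>)" by (simp add: add_pos_nonneg sum_nonneg)
      then have s: "0 < s" by (simp add: s_def)
      have "0 \<le> 1 + s * u i" if "i < m" for i
      proof -
        have "\<bar>u i\<bar> \<le> (\<Sum>i<m. \<bar>u i\<bar>)" using that by (intro member_le_sum) auto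
        then have "s * \<bar>u i\<bar> \<le> 1" using S by (simp add: s_def pos_divide_le_eq)
        moreover have "s * - u i \<le> s * \<bar>u i\<bar>" using s by (intro mult_left_mono) auto
        ultimately show ?thesis by simp
      qed
      then have N: "N s i \<in> normal_cone K (qs ! i)" if "i < m" for i using N_cone s that by simp
      \<comment> \<open>The reflection law for N s k makes G k a multiple of it, hence w a multiple of G k.
        A nonnegative factor is excluded by the choice of w, a negative one by pointedness.\<close>
      have Nk: "N s k = G k + (s * u k) *\<^sub>R w" by (simp add: N_def f_def)
      have su: "s * u k > 0" using s uk by simp
      have Nk0: "N s k \<noteq> 0"
      proof
        assume "N s k = 0"
        then have "- G k = (s * u k) *\<^sub>R w" unfolding Nk by (simp add: eq_neg_iff_add_eq_0 neg_eq_iff_add_eq_0)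
        then have "- G k \<in> normal_cone K (qs ! k)"
          using normal_cone_scale[OF w(1), of "s * u k"] su by simp
        then show False using normal_cone_pointed G k by blast
      qed
      have "k < length qs" using k by (simp add: m_def)
      have "\<forall>\<^sub>F x in at (qs ! k) within {x. N s k \<bullet> x = N s k \<bullet> (qs ! k)}.
          T_norm T (cyc_next qs k - qs ! k) + T_norm T (qs ! k - cyc_prev qs k)
          \<le> T_norm T (cyc_next qs k - x) + T_norm T (x - cyc_prev qs k)"
        using shortest_polygon_reflects[OF m2 \<open>k < length qs\<close>, of "N s"] N N_sum Nk0 min
        by (auto simp: eventually_at m_def intro!: exI[of _ 1])
      moreover have "cyc_prev qs k \<in> K"
        using traj \<open>k < length qs\<close>
        by (auto simp: closed_generalized_billiard_trajectory_def generalized_reflection_def)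
      ultimately obtain c where c: "c > 0" "G k = c *\<^sub>R N s k"
        using momentum_change_at_reflection[OF trajectory_momentum_change(3)[OF traj \<open>k < length qs\<close>]
            _ N[OF k] Nk0]
        by (auto simp: G_def momentum_change_def)
      define t where "t = (1 - c) / (c * (s * u k))"
      have "(c * (s * u k)) *\<^sub>R w = (1 - c) *\<^sub>R G k"
        using c(2) by (simp add: Nk algebra_simps)
      then have "(1 / (c * (s * u k))) *\<^sub>R ((c * (s * u k)) *\<^sub>R w) = t *\<^sub>R G k"
        by (simp add: t_def)
      then have wt: "w = t *\<^sub>R G k" using c(1) s uk by simp
      then have "t < 0" using w(2)[of t] not_le by blast
      then have "- G k = (- 1 / t) *\<^sub>R w" by (simp add: wt)
      then have "- G k \<in> normal_cone K (qs ! k)"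
        using normal_cone_scale[OF w(1), of "- 1 / t"] \<open>t < 0\<close> by simp
      then show False using normal_cone_pointed G k by blast
    qed
  qed
  then show ?thesis by (auto simp: classical_trajectory_def in_set_conv_nth m_def)
qed

end

theorem theorem4p8:
  fixes T K :: "(real ^ 'n) set" and qs :: "(real ^ 'n) list"
  assumes "convex_body T" and "0 \<in> interior T"
    and "smooth_body T" and "strictly_convex T"
    and "convex_body K"
    and "shortest_closed_generalized_billiard_trajectory K T qs"
    and "length qs = CARD('n) + 1"
  shows "classical_trajectory K qs"
proof -
  interpret billiard T K
    by unfold_locales (fact assms)+
  show ?thesis
    using assms(6,7) by (intro shortest_trajectory_classical) simp_all
qed

end
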